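(* Let $G$ be a graph with $m\ge 1$ edges. Then $$HM_1(G)\ge \frac{M_1(G)^2}{m},$$ and equality holds if and only if $G$ is edge degree regular.
   Context: Graphs are finite, without loops or multiple edges. For a vertex $u$, $d(u)$ is its degree. For an edge $e=uv$ the edge degree is $d(e)=d(u)+d(v)$. The first Zagreb index is $M_1(G)=\sum_{v\in V(G)}d(v)^2$. The first hyper-Zagreb index is $HM_1(G)=\sum_{e\in E(G)}d(e)^2$. A graph is edge degree regular if all its edges have the same edge degree $d(e)$. *)

theory Defs
  imports Complex_Main "Graph_Theory.Digraph"
begin

text \<open>
  A finite simple graph is a symmetric loop-free digraph without parallel arcs (locale
  \<^locale>\<open>graph\<close>), so every undirected edge is represented by two opposite arcs. The edges
  below are the unordered pairs of end points, hence each undirected edge is counted once.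
\<close>

definition edges :: "('a, 'b) pre_digraph \<Rightarrow> 'a set set" where
  "edges G = (\<lambda>a. {tail G a, head G a}) ` arcs G"

definition degree :: "('a, 'b) pre_digraph \<Rightarrow> 'a \<Rightarrow> nat" where
  "degree G v = card {e \<in> edges G. v \<in> e}"

definition edge_degree :: "('a, 'b) pre_digraph \<Rightarrow> 'a set \<Rightarrow> nat" where
  "edge_degree G e = (\<Sum>v\<in>e. degree G v)"

definition first_Zagreb :: "('a, 'b) pre_digraph \<Rightarrow> nat" where
  "first_Zagreb G = (\<Sum>v\<in>verts G. (degree G v)\<^sup>2)"

definition first_hyper_Zagreb :: "('a, 'b) pre_digraph \<Rightarrow> nat" where
  "first_hyper_Zagreb G = (\<Sum>e\<in>edges G. (edge_degree G e)\<^sup>2)"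

definition edge_degree_regular :: "('a, 'b) pre_digraph \<Rightarrow> bool" where
  "edge_degree_regular G \<longleftrightarrow>
    (\<forall>e\<in>edges G. \<forall>f\<in>edges G. edge_degree G e = edge_degree G f)"

lemma edge_degree_pair:
  assumes "graph G" and "{u, v} \<in> edges G"
  shows "edge_degree G {u, v} = degree G u + degree G v"
proof -
  interpret graph G by fact
  have "u \<noteq> v"
    using assms(2) by (auto simp: edges_def doubleton_eq_iff dest: no_loops)
  then show ?thesis
    by (simp add: edge_degree_def)
qed

lemma degree_eq_out_degree:
  assumes "graph G"
  shows "degree G v = out_degree G v"
proof -
  interpret graph G by fact
  let ?f = "\<lambda>a. {tail G a, head G a}"
  have "inj_on ?f (out_arcs G v)"
  proof (rule inj_onI)
    fix a b assume "a \<in> out_arcs G v" "b \<in> out_arcs G v" "?f a = ?f b"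
    then show "a = b"
      by (intro no_multi_arcs) (auto simp: arc_to_ends_def doubleton_eq_iff)
  qed
  moreover have "?f ` out_arcs G v = {e \<in> edges G. v \<in> e}"
  proof (intro subset_antisym subsetI)
    fix e assume "e \<in> {e \<in> edges G. v \<in> e}"
    then obtain a where a: "a \<in> arcs G" "e = ?f a" "v = tail G a \<or> v = head G a"
      by (auto simp: edges_def)
    obtain b where "b \<in> arcs G" "tail G a = head G b" "head G a = tail G b"
      using sym_arcs a(1) unfolding symmetric_conv by blast
    then show "e \<in> ?f ` out_arcs G v"
      using a by (auto simp: insert_commute intro: rev_image_eqI)
  qed (auto simp: edges_def)
  ultimately show ?thesis
    unfolding degree_def out_degree_def by (metis card_image)
qed

end

theory Submission
  imports Defs
begin

text \<open>
  Counting incident pairs of a vertex and an edge, weighted by the degree of the vertex, gives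
  that \<open>M\<^sub>1\<close> is the sum of the edge degrees. The inequality is then Cauchy-Schwarz for the edge
  degrees, and Lagrange's identity expresses the defect through the squared differences of the
  edge degrees, which yields the equality case.
\<close>

text \<open>Expand the square: each of the two pure terms sums to \<open>card A\<close> times the
  sum of squares, and the mixed term factors into the square of the sum.\<close>

lemma lagrange_identity_const:
  fixes f :: "'a \<Rightarrow> real"
  shows "(\<Sum>x\<in>A. \<Sum>y\<in>A. (f x - f y)\<^sup>2) =
    2 * (real (card A) * (\<Sum>x\<in>A. (f x)\<^sup>2) - (\<Sum>x\<in>A. f x)\<^sup>2)"
proof -
  have "(\<Sum>x\<in>A. \<Sum>y\<in>A. f x * f y) = (\<Sum>x\<in>A. f x)\<^sup>2"
    by (simp add: power2_eq_square sum_product)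
  moreover have "(\<Sum>x\<in>A. \<Sum>y\<in>A. (f x - f y)\<^sup>2) =
      (\<Sum>x\<in>A. \<Sum>y\<in>A. (f x)\<^sup>2) + (\<Sum>x\<in>A. \<Sum>y\<in>A. (f y)\<^sup>2)
      - 2 * (\<Sum>x\<in>A. \<Sum>y\<in>A. f x * f y)"
    by (simp add: power2_diff sum.distrib sum_subtractf sum_distrib_left mult.assoc)
  ultimately show ?thesis
    by (simp add: sum_distrib_left [symmetric])
qed

lemma sum_power2_card:
  fixes f :: "'a \<Rightarrow> real"
  assumes "finite A"
  shows sum_power2_le_card: "(\<Sum>x\<in>A. f x)\<^sup>2 \<le> real (card A) * (\<Sum>x\<in>A. (f x)\<^sup>2)"
    and sum_power2_eq_card_iff: "real (card A) * (\<Sum>x\<in>A. (f x)\<^sup>2) = (\<Sum>x\<in>A. f x)\<^sup>2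
      \<longleftrightarrow> (\<forall>x\<in>A. \<forall>y\<in>A. f x = f y)"
proof -
  have "0 \<le> (\<Sum>x\<in>A. \<Sum>y\<in>A. (f x - f y)\<^sup>2)"
    by (simp add: sum_nonneg)
  then show "(\<Sum>x\<in>A. f x)\<^sup>2 \<le> real (card A) * (\<Sum>x\<in>A. (f x)\<^sup>2)"
    by (simp add: lagrange_identity_const)
  \<comment> \<open>A finite sum of nonnegative terms vanishes only if every term does; this is
    applied to both the outer and the inner sum.\<close>
  have "(\<Sum>x\<in>A. \<Sum>y\<in>A. (f x - f y)\<^sup>2) = 0 \<longleftrightarrow> (\<forall>x\<in>A. \<forall>y\<in>A. f x = f y)"
    using assms by (simp add: sum_nonneg_eq_0_iff sum_nonneg)
  then show "real (card A) * (\<Sum>x\<in>A. (f x)\<^sup>2) = (\<Sum>x\<in>A. f x)\<^sup>2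
      \<longleftrightarrow> (\<forall>x\<in>A. \<forall>y\<in>A. f x = f y)"
    by (simp add: lagrange_identity_const)
qed

lemma first_Zagreb_eq_sum_edge_degree:
  assumes "graph G"
  shows "first_Zagreb G = (\<Sum>e\<in>edges G. edge_degree G e)"
proof -
  interpret graph G by fact
  \<comment> \<open>Both ends of an edge are vertices of \<open>G\<close>, so the sum in
    \<open>edge_degree\<close> can run over the incident members of \<open>verts G\<close>, the form
    in which the two summations can be swapped.\<close>
  have "{v \<in> verts G. v \<in> e} = e" if "e \<in> edges G" for e
    using that by (auto simp: edges_def)
  then have "(\<Sum>e\<in>edges G. edge_degree G e) =
      (\<Sum>e\<in>edges G. \<Sum>v\<in>{v \<in> verts G. v \<in> e}. degree G v)"
    by (simp add: edge_degree_def)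
  also have "\<dots> = (\<Sum>v\<in>verts G. \<Sum>e\<in>{e \<in> edges G. v \<in> e}. degree G v)"
    by (rule sum.swap_restrict) (simp_all add: edges_def)
  \<comment> \<open>For fixed \<open>v\<close> the inner sum has \<open>degree G v\<close> equal
    summands \<open>degree G v\<close>, hence the square.\<close>
  also have "\<dots> = first_Zagreb G"
    by (simp add: first_Zagreb_def power2_eq_square degree_def)
  finally show ?thesis ..
qed

theorem theorem2:
  fixes G :: "('a, 'b) pre_digraph" and m :: nat
  assumes "graph G"
    and "m = card (edges G)"
    and "m \<ge> 1"
  shows "real (first_hyper_Zagreb G) \<ge> (real (first_Zagreb G))\<^sup>2 / real m
    \<and> (real (first_hyper_Zagreb G) = (real (first_Zagreb G))\<^sup>2 / real m
        \<longleftrightarrow> edge_degree_regular G)"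
proof -
  let ?d = "\<lambda>e. real (edge_degree G e)"
  \<comment> \<open>An infinite set has \<open>card\<close> 0, which \<open>m \<ge> 1\<close>
    excludes.\<close>
  have fin: "finite (edges G)"
    using assms(2,3) by (metis card.infinite not_one_le_zero)
  have M: "real (first_Zagreb G) = (\<Sum>e\<in>edges G. ?d e)"
    by (simp add: first_Zagreb_eq_sum_edge_degree [OF assms(1)])
  have HM: "real (first_hyper_Zagreb G) = (\<Sum>e\<in>edges G. (?d e)\<^sup>2)"
    by (simp add: first_hyper_Zagreb_def)
  \<comment> \<open>Both claims are first shown with the denominator cleared; as \<open>m\<close> is
    positive, dividing by it preserves them.\<close>
  have "(real (first_Zagreb G))\<^sup>2 \<le> real m * real (first_hyper_Zagreb G)"
    unfolding M HM assms(2) by (rule sum_power2_le_card [OF fin])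
  moreover have "real m * real (first_hyper_Zagreb G) = (real (first_Zagreb G))\<^sup>2
      \<longleftrightarrow> edge_degree_regular G"
    unfolding M HM assms(2) sum_power2_eq_card_iff [OF fin]
    by (simp add: edge_degree_regular_def)
  ultimately show ?thesis
    using assms(3) by (simp add: field_simps)
qed

end
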